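(* Let $i, n, q$ be positive integers and let $k$ be a non-negative integer. Then $$\lim_{z\to -k}\frac{\psi^{(i)}(nz)}{\psi^{(i)}(qz)}=\left(\frac{q}{n}\right)^{i+1}.$$
   Context: $\Gamma(z)$ denotes the Euler gamma function, which is single valued and analytic on the entire complex plane except for simple poles at the points $z=0,-1,-2,\dots$. The digamma function is $\psi(z)=\Gamma'(z)/\Gamma(z)$, and for a positive integer $i$, $\psi^{(i)}(z)$ denotes the $i$-th derivative of $\psi$ (a polygamma function); it is single valued and analytic on the entire complex plane except at the points $z=-m$, $m\in\{0,1,2,\dots\}$, where it has poles of order $i+1$. The expressions $\psi^{(i)}(nz)$ and $\psi^{(i)}(qz)$ mean the function $\psi^{(i)}$ evaluated at $nz$ and $qz$ respectively. The limit is taken as the complex variable $z$ tends to the point $-k$, with $z\neq -k$. *)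

theory Defs
  imports "HOL-Analysis.Analysis"
begin

text \<open>
  The library defines \<^const>\<open>Polygamma\<close> by series. The following fact confirms that, away from
  the poles, it is the iterated derivative of the logarithmic derivative of \<^const>\<open>Gamma\<close>.
\<close>

lemma Polygamma_eq_higher_deriv:
  fixes z :: complex
  assumes "z \<notin> \<int>\<^sub>\<le>\<^sub>0"
  shows "Polygamma i z = (deriv ^^ i) (\<lambda>w. deriv Gamma w / Gamma w) z"
proof -
  have "eventually (\<lambda>w::complex. w \<in> - \<int>\<^sub>\<le>\<^sub>0) (nhds z)"
    using assms by (intro eventually_nhds_in_open) auto
  then have ev: "eventually (\<lambda>w. deriv Gamma w / Gamma w = Polygamma 0 w) (nhds z)"
    by eventually_elim
      (auto simp: Gamma_eq_zero_iff intro!: DERIV_imp_deriv[OF has_field_derivative_Gamma, THEN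
        arg_cong[where f = "\<lambda>d. d / Gamma _"], THEN trans])
  have "(deriv ^^ i) (\<lambda>w. deriv Gamma w / Gamma w) z = (deriv ^^ i) (Polygamma 0) z"
    using ev by (rule higher_deriv_cong_ev) simp
  also have "\<dots> = Polygamma i z"
    using higher_deriv_Polygamma[OF assms, of i 0] by simp
  finally show ?thesis by simp
qed

end

theory Submission
  imports Defs
begin

text \<open>
  The recurrence for \<^term>\<open>Polygamma i (w + 1)\<close> moves the pole at \<open>-m\<close> to the one at \<open>0\<close>, so
  \<open>\<psi>\<^sup>(\<^sup>i\<^sup>)\<close> has leading coefficient \<open>(-1)\<^sup>i\<^sup>+\<^sup>1 i!\<close> at every pole, independently of \<open>m\<close>.
  In the quotient these coefficients cancel and only the ratio of \<open>(q (z + k))\<^sup>i\<^sup>+\<^sup>1\<close> to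
  \<open>(n (z + k))\<^sup>i\<^sup>+\<^sup>1\<close> survives.
\<close>

text \<open>Induction on \<open>m\<close>: the correction term of the recurrence creates the pole at
  0 and is regular at every other pole.\<close>

lemma tendsto_Polygamma_at_pole:
  "((\<lambda>w::complex. (w + of_nat m) ^ Suc i * Polygamma i w) \<longlongrightarrow> (-1) ^ Suc i * fact i)
     (at (- of_nat m))"
proof (induction m)
  case 0
  \<comment> \<open>Since 1 is not a pole, the factor \<open>w ^ Suc i\<close> kills the shifted
    term in the limit; only the correction survives.\<close>
  have cont: "isCont (\<lambda>w::complex. Polygamma i (w + 1)) 0"
    by (intro isCont_Polygamma continuous_intros) simp
  have "((\<lambda>w::complex. w ^ Suc i * Polygamma i (w + 1) - (-1) ^ i * fact i) \<longlongrightarrow>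
          0 ^ Suc i * Polygamma i (0 + 1) - (-1) ^ i * fact i) (at 0)"
    by (intro tendsto_intros isContD[OF cont])
  moreover have "\<forall>\<^sub>F w::complex in at 0.
      w ^ Suc i * Polygamma i (w + 1) - (-1) ^ i * fact i = w ^ Suc i * Polygamma i w"
    using eventually_neq_at_within[of 0]
    by eventually_elim (simp add: Polygamma_plus1 distrib_left del: power_Suc)
  ultimately have "((\<lambda>w::complex. w ^ Suc i * Polygamma i w) \<longlongrightarrow>
      0 ^ Suc i * Polygamma i (0 + 1) - (-1) ^ i * fact i) (at 0)"
    by (rule Lim_transform_eventually)
  then show ?case
    by simp
next
  case (Suc m)
  let ?a = "- of_nat (Suc m) :: complex"
  \<comment> \<open>The limits are punctured, so composing also requires that the shift avoid
    \<open>- of_nat m\<close>.\<close>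
  have "filterlim (\<lambda>w. w + 1) (at (- of_nat m)) (at ?a)"
  proof (rule filterlim_atI)
    show "((\<lambda>w. w + 1) \<longlongrightarrow> - of_nat m) (at ?a)"
      by (auto intro!: tendsto_eq_intros)
    show "\<forall>\<^sub>F w in at ?a. w + 1 \<noteq> - of_nat m"
      using eventually_neq_at_within[of ?a]
      by eventually_elim (simp only: eq_neg_iff_add_eq_0 of_nat_Suc add.assoc not_False_eq_True)
  qed
  note shifted = filterlim_compose[OF Suc.IH this]
  \<comment> \<open>As \<open>?a\<close> is nonzero, the correction is finite there and its
    vanishing prefactor removes it.\<close>
  have "((\<lambda>w. (w + 1 + of_nat m) ^ Suc i * Polygamma i (w + 1)
            - (w + of_nat (Suc m)) ^ Suc i * ((-1) ^ i * fact i / w ^ Suc i)) \<longlongrightarrow>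
          (-1) ^ Suc i * fact i
            - (?a + of_nat (Suc m)) ^ Suc i * ((-1) ^ i * fact i / ?a ^ Suc i)) (at ?a)"
    by (rule tendsto_diff[OF shifted], intro tendsto_intros) (simp del: of_nat_Suc)
  also have "(?a + of_nat (Suc m)) ^ Suc i = 0"
    by simp
  finally have lim: "((\<lambda>w. (w + 1 + of_nat m) ^ Suc i * Polygamma i (w + 1)
            - (w + of_nat (Suc m)) ^ Suc i * ((-1) ^ i * fact i / w ^ Suc i)) \<longlongrightarrow>
          (-1) ^ Suc i * fact i) (at ?a)"
    by simp
  have "\<forall>\<^sub>F w in at ?a. w \<noteq> 0"
    by (rule tendsto_imp_eventually_ne[OF tendsto_ident_at]) (simp del: of_nat_Suc)
  then have "\<forall>\<^sub>F w in at ?a. (w + 1 + of_nat m) ^ Suc i * Polygamma i (w + 1)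
            - (w + of_nat (Suc m)) ^ Suc i * ((-1) ^ i * fact i / w ^ Suc i)
          = (w + of_nat (Suc m)) ^ Suc i * Polygamma i w"
  proof eventually_elim
    case (elim w)
    have "w + 1 + of_nat m = w + of_nat (Suc m)"
      by simp
    then show ?case
      by (simp only: Polygamma_plus1[OF elim] distrib_left add_diff_cancel_right')
  qed
  with lim show ?case
    by (rule Lim_transform_eventually)
qed

text \<open>Substituting \<open>w = of_nat n * z\<close> carries \<open>-k\<close> to the pole
  \<open>-(n * k)\<close>, and \<open>w + n * k\<close> factors as
  \<open>n * (z + k)\<close>.\<close>

lemma tendsto_Polygamma_scaled_at_pole:
  assumes "n > 0"
  shows "((\<lambda>z::complex. (of_nat n * (z + of_nat k)) ^ Suc i * Polygamma i (of_nat n * z))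
           \<longlongrightarrow> (-1) ^ Suc i * fact i) (at (- of_nat k))"
proof -
  have "filterlim (\<lambda>z::complex. of_nat n * z) (at (- of_nat (n * k))) (at (- of_nat k))"
  proof (rule filterlim_atI)
    show "((\<lambda>z::complex. of_nat n * z) \<longlongrightarrow> - of_nat (n * k)) (at (- of_nat k))"
      by (auto intro!: tendsto_eq_intros)
    show "\<forall>\<^sub>F z::complex in at (- of_nat k). of_nat n * z \<noteq> - of_nat (n * k)"
      using eventually_neq_at_within[of "- of_nat k"]
    proof eventually_elim
      case (elim z)
      then have "of_nat n * z \<noteq> of_nat n * - of_nat k"
        using assms by (simp only: mult_cancel_left) simp
      then show ?case
        by (simp only: of_nat_mult mult_minus_right not_False_eq_True)
    qed
  qed
  from filterlim_compose[OF tendsto_Polygamma_at_pole this] show ?thesis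
    by (simp add: distrib_left)
qed

theorem theorem1p1:
  fixes i n q k :: nat
  assumes "i > 0" and "n > 0" and "q > 0"
  shows "((\<lambda>z::complex. Polygamma i (of_nat n * z) / Polygamma i (of_nat q * z))
           \<longlongrightarrow> (of_nat q / of_nat n) ^ (i + 1)) (at (- of_nat k))"
proof -
  let ?F = "\<lambda>m z::complex. (of_nat m * (z + of_nat k)) ^ Suc i * Polygamma i (of_nat m * z)"
  let ?c = "(-1) ^ Suc i * fact i :: complex"
  \<comment> \<open>The prefactor undoes the ratio of the normalizing powers; \<open>?c\<close> is
    nonzero, so the quotient rule applies.\<close>
  have "((\<lambda>z. (of_nat q / of_nat n) ^ Suc i * (?F n z / ?F q z)) \<longlongrightarrow>
          (of_nat q / of_nat n) ^ Suc i * (?c / ?c)) (at (- of_nat k))"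
    using assms by (intro tendsto_intros tendsto_Polygamma_scaled_at_pole) auto
  moreover have "\<forall>\<^sub>F z in at (- of_nat k). (of_nat q / of_nat n) ^ Suc i * (?F n z / ?F q z)
      = Polygamma i (of_nat n * z) / Polygamma i (of_nat q * z)"
    \<comment> \<open>Off \<open>-k\<close> the powers of \<open>z + of_nat k\<close> cancel. Where
      the denominator vanishes, both sides are 0 because \<open>x / 0 = 0\<close>.\<close>
    using eventually_neq_at_within[of "- of_nat k"]
  proof eventually_elim
    case (elim z)
    then have "z + of_nat k \<noteq> 0"
      by (simp add: eq_neg_iff_add_eq_0)
    with assms show ?case
      by (simp add: power_mult_distrib power_divide del: power_Suc)
  qed
  ultimately have "((\<lambda>z. Polygamma i (of_nat n * z) / Polygamma i (of_nat q * z))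
      \<longlongrightarrow> (of_nat q / of_nat n) ^ Suc i * (?c / ?c)) (at (- of_nat k))"
    by (rule Lim_transform_eventually)
  then show ?thesis
    by simp
qed

end
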